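(* Let $x_0\ge 0$ be an integer, let $\lambda_0, s_0$ be functions on the integers $x\ge x_0$, and define functions $\lambda_k, s_k$ for $k\ge 1$ recursively by $$\lambda_k(x)=\Delta \lambda_{k-1}(x)+\lambda_{k-1}(x+1)\lambda_0(x)+s_{k-1}(x+1),\qquad s_k(x)=\Delta s_{k-1}(x)+\lambda_{k-1}(x+1)s_0(x).$$ Suppose that for some integer $n\ge 1$, $$\frac{s_n(x)}{\lambda_n(x)}=\frac{s_{n-1}(x)}{\lambda_{n-1}(x)}\qquad\text{for all integers } x\ge x_0 .$$ Then $$y(x)=\prod_{i=x_0}^{x-1}\left[1-\frac{s_{n-1}(i)}{\lambda_{n-1}(i)}\right],\qquad x=x_0,x_0+1,x_0+2,\dots,$$ is a solution of the difference equation $$\Delta^2 y(x)=\lambda_0(x)\,\Delta y(x)+s_0(x)\,y(x).$$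
   Context: $\Delta$ is the forward difference operator, $\Delta f(x)=f(x+1)-f(x)$, and $\Delta^2=\Delta\circ\Delta$. Functions are real (or complex) valued. An empty product equals $1$. The quotients appearing in the statement are assumed to be defined, i.e. $\lambda_{n-1}(x)\neq 0$ and $\lambda_n(x)\ne 0$ for all $x$ considered. *)

theory Defs
  imports Complex_Main
begin

(* The class real_normed_field covers real- and complex-valued functions at once.
   A function on the integers x >= x0 is represented by a total function on int;
   since the operator looks only at x and x + 1, values below x0 play no role. *)
definition fdiff :: "(int \<Rightarrow> 'a::real_normed_field) \<Rightarrow> int \<Rightarrow> 'a"  (\<open>\<Delta>\<close>)
  where "\<Delta> f x = f (x + 1) - f x"

end

theory Submission imports Defs begin

text \<open>
  With \<open>a = s (n - 1) / lam (n - 1)\<close>, the recursions turn \<open>s n / lam n = a\<close> into the Riccati equation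
  \<open>a (x + 1) + s 0 x = a x * (1 + lam 0 x + a (x + 1))\<close>. The product satisfies the first-order equation
  \<open>\<Delta> y = - a * y\<close>, and the Riccati equation is exactly what makes its solutions solve the second-order one.
\<close>

text \<open>Eliminating \<open>y (x + 2)\<close>, \<open>y (x + 1)\<close> and \<open>q x\<close>
  makes both sides equal to \<open>(a x - a (x + 1) + a x * a (x + 1)) * y x\<close>; the terms in
  \<open>p x\<close> cancel.\<close>

lemma second_difference_of_first_order_solution:
  fixes y a p q :: "int \<Rightarrow> 'a::real_normed_field"
  assumes "y (x + 1) = (1 - a x) * y x"
    and "y (x + 2) = (1 - a (x + 1)) * y (x + 1)"
    and riccati: "a (x + 1) + q x = a x * (1 + p x + a (x + 1))"
  shows "\<Delta> (\<Delta> y) x = p x * \<Delta> y x + q x * y x"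
proof -
  have q: "q x = a x * (1 + p x + a (x + 1)) - a (x + 1)"
    using riccati by (simp add: algebra_simps)
  have "\<Delta> (\<Delta> y) x = y (x + 2) - y (x + 1) - (y (x + 1) - y x)"
    by (simp add: fdiff_def add.assoc)
  then show ?thesis
    unfolding fdiff_def q assms(1,2) by (simp add: algebra_simps)
qed

theorem theorem3p3:
  fixes x0 :: int
    and lam s :: "nat \<Rightarrow> int \<Rightarrow> 'a::real_normed_field"
    and y :: "int \<Rightarrow> 'a"
    and n :: nat
  assumes x0_nonneg: "x0 \<ge> 0"
    and lam_rec: "\<And>k x. k \<ge> 1 \<Longrightarrow> x \<ge> x0 \<Longrightarrow>
          lam k x = \<Delta> (lam (k - 1)) x + lam (k - 1) (x + 1) * lam 0 x + s (k - 1) (x + 1)"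
    and s_rec: "\<And>k x. k \<ge> 1 \<Longrightarrow> x \<ge> x0 \<Longrightarrow>
          s k x = \<Delta> (s (k - 1)) x + lam (k - 1) (x + 1) * s 0 x"
    and n_pos: "n \<ge> 1"
    and lam_pred_nz: "\<And>x. x \<ge> x0 \<Longrightarrow> lam (n - 1) x \<noteq> 0"
    and lam_nz: "\<And>x. x \<ge> x0 \<Longrightarrow> lam n x \<noteq> 0"
    and ratio_eq: "\<And>x. x \<ge> x0 \<Longrightarrow> s n x / lam n x = s (n - 1) x / lam (n - 1) x"
    and y_eq: "\<And>x. x \<ge> x0 \<Longrightarrow> y x = (\<Prod>i = x0..x - 1. 1 - s (n - 1) i / lam (n - 1) i)"
  shows "\<forall>x\<ge>x0. \<Delta> (\<Delta> y) x = lam 0 x * \<Delta> y x + s 0 x * y x"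
proof (intro allI impI)
  fix x assume x: "x \<ge> x0"
  define a where "a z = s (n - 1) z / lam (n - 1) z" for z
  have step: "y (z + 1) = (1 - a z) * y z" if "z \<ge> x0" for z
  proof -
    \<comment> \<open>Splits off the last factor; for \<open>z = x0\<close> the remaining interval
      is empty, so \<open>y x0 = 1\<close>.\<close>
    have "{x0..z} = insert z {x0..z - 1}" using that by auto
    then show ?thesis using that by (simp add: y_eq a_def)
  qed
  have s_eq: "s (n - 1) z = a z * lam (n - 1) z" if "z \<ge> x0" for z
    using lam_pred_nz[OF that] by (simp add: a_def)
  have s_eq1: "s (n - 1) (x + 1) = a (x + 1) * lam (n - 1) (x + 1)"
    using s_eq x by simp
  have "s n x = a x * lam n x"
    using ratio_eq[OF x] lam_nz[OF x] by (simp add: a_def divide_eq_eq)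
  \<comment> \<open>After the recursions are expanded, \<open>a x * lam (n - 1) x\<close> occurs on
    both sides and cancels. Every remaining term has the factor \<open>lam (n - 1) (x + 1)\<close>,
    which is nonzero.\<close>
  then have "lam (n - 1) (x + 1) * (a (x + 1) + s 0 x)
      = lam (n - 1) (x + 1) * (a x * (1 + lam 0 x + a (x + 1)))"
    unfolding lam_rec[OF n_pos x] s_rec[OF n_pos x] fdiff_def s_eq[OF x] s_eq1
    by (simp only: algebra_simps) simp
  then have "a (x + 1) + s 0 x = a x * (1 + lam 0 x + a (x + 1))"
    using lam_pred_nz[of "x + 1"] x by simp
  then show "\<Delta> (\<Delta> y) x = lam 0 x * \<Delta> y x + s 0 x * y x"
    using step[OF x] step[of "x + 1"] x
    by (intro second_difference_of_first_order_solution) (simp_all add: add.assoc)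
qed

end
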